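(* Let $n\ge 1$ and $\lambda\in[1/(n+1),1/2]$. Suppose that $P,Q\in\mathrm{VG}(\mathbb{R}^n,\lambda)$ are centrally symmetric polytopes that form a generic pair. Then $P+Q\in\mathrm{VG}(\mathbb{R}^n,\lambda)$.
   Context: A polytope in $\mathbb{R}^n$ is the convex hull of a finite non-empty set of points; $V(P)$ denotes the set of vertices of $P$; $A+B=\{a+b: a\in A,b\in B\}$ is the Minkowski sum. For a polytope $P\subset\mathbb{R}^n$ let $\lambda(P)=\sup\{\lambda\in\mathbb{R}: P=(1-\lambda)P+\lambda V(P)\}$ (value in $(-\infty,+\infty]$; it is $+\infty$ exactly when $P$ is a single point). $P$ is called $\lambda$-vertex generated if $\lambda(P)\ge\lambda$, and $\mathrm{VG}(\mathbb{R}^n,\lambda)$ is the class of $\lambda$-vertex generated polytopes in $\mathbb{R}^n$. A polytope is centrally symmetric if it is symmetric about some point, i.e. $P=2c-P$ for some $c\in\mathbb{R}^n$. For a vertex $v$ of a polytope $P$, the normal cone is $N_P(v)=\{y\in\mathbb{R}^n:\langle y,x-v\rangle\le 0\ \ \forall x\in P\}$. Two polytopes $P,Q\subseteq\mathbb{R}^n$ with non-empty interior are called a generic pair if for all $v\in V(P)$ and $w\in V(Q)$: $N_P(v)\cap N_Q(w)\neq\{0\}$ implies $\mathrm{int}(N_P(v))\cap\mathrm{int}(N_Q(w))\neq\emptyset$. *)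

theory Defs
  imports "HOL-Analysis.Analysis" "HOL-Library.Set_Algebras"
begin

definition vertices :: "'a::euclidean_space set \<Rightarrow> 'a set" where
  "vertices P = {v. v extreme_point_of P}"

(* The Minkowski sum is the operation + on sets from Set_Algebras.  The supremum is taken in
   ereal, since the set of admissible parameters is unbounded when P is a single point. *)
definition vg_parameter :: "'a::euclidean_space set \<Rightarrow> ereal" where
  "vg_parameter P =
     (SUP l \<in> {l::real. P = (\<lambda>x. (1 - l) *\<^sub>R x) ` P + (\<lambda>v. l *\<^sub>R v) ` vertices P}. ereal l)"

(* The library's polytope includes the empty set, which is excluded here. *)
definition VG :: "real \<Rightarrow> 'a::euclidean_space set set" where
  "VG l = {P. polytope P \<and> P \<noteq> {} \<and> ereal l \<le> vg_parameter P}"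

definition centrally_symmetric :: "'a::euclidean_space set \<Rightarrow> bool" where
  "centrally_symmetric P \<longleftrightarrow> (\<exists>c. P = (\<lambda>x. 2 *\<^sub>R c - x) ` P)"

definition normal_cone :: "'a::euclidean_space set \<Rightarrow> 'a \<Rightarrow> 'a set" where
  "normal_cone P v = {y. \<forall>x\<in>P. y \<bullet> (x - v) \<le> 0}"

definition generic_pair :: "'a::euclidean_space set \<Rightarrow> 'a set \<Rightarrow> bool" where
  "generic_pair P Q \<longleftrightarrow>
     polytope P \<and> polytope Q \<and> interior P \<noteq> {} \<and> interior Q \<noteq> {} \<and>
     (\<forall>v\<in>vertices P. \<forall>w\<in>vertices Q.
        normal_cone P v \<inter> normal_cone Q w \<noteq> {0} \<longrightarrow>
        interior (normal_cone P v) \<inter> interior (normal_cone Q w) \<noteq> {})"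

end

theory Submission
  imports Defs
begin

text \<open>
  A boundary point of \<open>P + Q\<close> is \<open>p + q\<close> with \<open>p\<close> and \<open>q\<close> maximising a common non-zero functional;
  since \<open>l > 0\<close>, the vertices generating \<open>p\<close> and \<open>q\<close> maximise it too, and genericity makes their
  sum a vertex of \<open>P + Q\<close>.  An interior point is a convex combination of the centre and a
  boundary point, and a vertex generating the boundary point also generates the interior point
  because \<open>l \<le> 1/2\<close>.
\<close>

section \<open>Vertex generation point by point\<close>

text \<open>For \<open>l\<close> in [0,1], convexity gives one inclusion of the defining equation
  for free. What remains is this condition at each \<open>x\<close> of \<open>P\<close>, so boundary
  and interior points can be treated separately.\<close>

definition generated_at :: "real \<Rightarrow> 'a::euclidean_space set \<Rightarrow> 'a \<Rightarrow> bool" where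
  "generated_at l P x \<longleftrightarrow> (\<exists>p\<in>P. \<exists>v\<in>vertices P. x = (1 - l) *\<^sub>R p + l *\<^sub>R v)"

lemma vertices_subset: "v \<in> vertices P \<Longrightarrow> v \<in> P"
  by (simp add: vertices_def extreme_point_of_def)

lemma vertex_generated_iff:
  assumes "convex P" "0 \<le> l" "l \<le> 1"
  shows "P = (\<lambda>x. (1 - l) *\<^sub>R x) ` P + (\<lambda>v. l *\<^sub>R v) ` vertices P \<longleftrightarrow> (\<forall>x\<in>P. generated_at l P x)"
proof -
  have "(1 - l) *\<^sub>R p + l *\<^sub>R v \<in> P" if "p \<in> P" "v \<in> vertices P" for p v
    using that assms vertices_subset by (intro convexD) auto
  then have "(\<lambda>x. (1 - l) *\<^sub>R x) ` P + (\<lambda>v. l *\<^sub>R v) ` vertices P \<subseteq> P"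
    by (auto simp: set_plus_def)
  moreover have "(\<lambda>x. (1 - l) *\<^sub>R x) ` P + (\<lambda>v. l *\<^sub>R v) ` vertices P = {x. generated_at l P x}"
    by (auto simp: set_plus_def generated_at_def)
  ultimately show ?thesis
    by blast
qed

text \<open>For \<open>k \<le> 1\<close>, the surplus weight \<open>k - l\<close> on
  \<open>v\<close> is absorbed into the point of \<open>P\<close>, by convexity. Larger
  \<open>k\<close> must be covered too, since the supremum in \<open>vg_parameter\<close> runs over
  all reals.\<close>

lemma generated_at_mono:
  assumes "convex P" "x \<in> P" "generated_at k P x" "l \<le> k" "l < 1"
  shows "generated_at l P x"
proof -
  obtain p v where p: "p \<in> P" and v: "v \<in> vertices P" and x: "x = (1 - k) *\<^sub>R p + k *\<^sub>R v"
    using assms(3) by (auto simp: generated_at_def)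
  have vP: "v \<in> P"
    using v by (rule vertices_subset)
  show ?thesis
  proof (cases "k \<le> 1")
    case True
    define z where "z = ((1 - k) / (1 - l)) *\<^sub>R p + ((k - l) / (1 - l)) *\<^sub>R v"
    have "(1 - k) / (1 - l) + (k - l) / (1 - l) = 1"
      using \<open>l < 1\<close> by (simp flip: add_divide_distrib)
    then have "z \<in> P"
      unfolding z_def using assms(1,4,5) True p vP by (intro convexD) auto
    moreover have "(1 - l) *\<^sub>R z = (1 - k) *\<^sub>R p + (k - l) *\<^sub>R v"
      using \<open>l < 1\<close> by (simp add: z_def scaleR_add_right)
    then have "x = (1 - l) *\<^sub>R z + l *\<^sub>R v"
      by (simp add: x scaleR_left_diff_distrib)
    ultimately show ?thesis
      using v by (auto simp: generated_at_def)
  next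
    \<comment> \<open>Here \<open>v\<close> lies strictly between \<open>p\<close> and \<open>x\<close>, unless all three coincide.\<close>
    case False
    have "(1 / k) *\<^sub>R x = (1 / k - 1) *\<^sub>R p + v"
      using False by (simp add: x scaleR_add_right diff_divide_distrib)
    then have v_eq: "v = (1 - 1 / k) *\<^sub>R p + (1 / k) *\<^sub>R x"
      by (simp add: scaleR_left_diff_distrib)
    have "0 < 1 / k" "1 / k < 1"
      using False by auto
    then have "v \<in> open_segment p x" if "p \<noteq> x"
      using that v_eq unfolding in_segment by blast
    then have "p = x"
      using v p \<open>x \<in> P\<close> by (auto simp: vertices_def extreme_point_of_def)
    then have "v = x"
      unfolding v_eq by (simp add: scaleR_left_diff_distrib)
    then have "x = (1 - l) *\<^sub>R x + l *\<^sub>R v"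
      by (simp add: scaleR_left_diff_distrib)
    then show ?thesis
      using v \<open>x \<in> P\<close> unfolding generated_at_def by blast
  qed
qed

text \<open>Attainment of the supremum is not assumed: the strict inequality \<open>l < k\<close>
  supplies an admissible \<open>m > l\<close>, and monotonicity brings \<open>m\<close> down to
  \<open>l\<close>.\<close>

lemma VG_generated_at:
  assumes "P \<in> VG k" "l < k" "0 \<le> l" "l < 1" "x \<in> P"
  shows "generated_at l P x"
proof -
  have "convex P"
    using assms(1) by (simp add: VG_def polytope_imp_convex)
  have "ereal l < vg_parameter P"
    using assms(1,2) by (auto simp: VG_def intro: less_le_trans[of _ "ereal k"])
  then obtain m where "l < m"
    and m: "P = (\<lambda>x. (1 - m) *\<^sub>R x) ` P + (\<lambda>v. m *\<^sub>R v) ` vertices P"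
    by (auto simp: vg_parameter_def less_SUP_iff)
  have "x \<in> (\<lambda>x. (1 - m) *\<^sub>R x) ` P + (\<lambda>v. m *\<^sub>R v) ` vertices P"
    using \<open>x \<in> P\<close> m by simp
  then have "generated_at m P x"
    by (auto simp: set_plus_def generated_at_def)
  then show ?thesis
    using generated_at_mono \<open>convex P\<close> \<open>x \<in> P\<close> \<open>l < m\<close> \<open>l < 1\<close> by (metis less_imp_le)
qed

text \<open>By density of the order, parameters strictly below \<open>k\<close> suffice to bound the
  supremum; this matches the strict inequality in \<open>VG_generated_at\<close>.\<close>

lemma VG_I:
  assumes "polytope P" "P \<noteq> {}" "0 < k" "k \<le> 1"
    and gen: "\<And>l x. 0 < l \<Longrightarrow> l < k \<Longrightarrow> x \<in> P \<Longrightarrow> generated_at l P x"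
  shows "P \<in> VG k"
proof -
  have "ereal k \<le> vg_parameter P"
  proof (rule dense_le_bounded)
    show "ereal 0 < ereal k"
      using \<open>0 < k\<close> by simp
    fix y assume y: "ereal 0 < y" "y < ereal k"
    then obtain l where l: "y = ereal l" "0 < l" "l < k"
      by (cases y) auto
    have "\<forall>x\<in>P. generated_at l P x"
      using gen l by blast
    then have "P = (\<lambda>x. (1 - l) *\<^sub>R x) ` P + (\<lambda>v. l *\<^sub>R v) ` vertices P"
      using vertex_generated_iff[of P l] assms(1,4) l polytope_imp_convex by force
    then show "y \<le> vg_parameter P"
      unfolding vg_parameter_def l(1) by (intro SUP_upper) simp
  qed
  then show ?thesis
    using assms(1,2) by (simp add: VG_def)
qed

section \<open>Common maximisers and vertices of the sum\<close>

text \<open>An interior \<open>y\<close> can be tilted slightly towards \<open>x - v\<close> without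
  leaving the cone; equality at \<open>x\<close> would then become a violation.\<close>

lemma interior_normal_cone_less:
  assumes "y \<in> interior (normal_cone P v)" "x \<in> P" "x \<noteq> v"
  shows "y \<bullet> x < y \<bullet> v"
proof -
  obtain e where e: "0 < e" "ball y e \<subseteq> normal_cone P v"
    using assms(1) by (auto simp: mem_interior)
  \<comment> \<open>The tilt \<open>r *\<^sub>R (x - v)\<close> has norm \<open>e / 2\<close>, so it
    stays inside the ball.\<close>
  define r where "r = e / (2 * norm (x - v))"
  have pos: "norm (x - v) > 0"
    using \<open>x \<noteq> v\<close> by simp
  have "0 < r"
    using pos e by (simp add: r_def)
  have "y + r *\<^sub>R (x - v) \<in> ball y e"
    using pos e by (simp add: dist_norm r_def)
  then have "(y + r *\<^sub>R (x - v)) \<bullet> (x - v) \<le> 0"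
    using e(2) \<open>x \<in> P\<close> by (auto simp: normal_cone_def)
  moreover have "0 < r * ((x - v) \<bullet> (x - v))"
    using \<open>0 < r\<close> \<open>x \<noteq> v\<close> by simp
  ultimately show ?thesis
    by (simp add: inner_add_left inner_diff_right[of y])
qed

lemma strict_maximiser_vertex:
  assumes "u \<in> K" and less: "\<And>x. x \<in> K \<Longrightarrow> x \<noteq> u \<Longrightarrow> y \<bullet> x < y \<bullet> u"
  shows "u \<in> vertices K"
proof -
  have False if ab: "a \<in> K" "b \<in> K" and "u \<in> open_segment a b" for a b
  proof -
    obtain s where "a \<noteq> b" and s: "0 < s" "s < 1" and u: "u = (1 - s) *\<^sub>R a + s *\<^sub>R b"
      using \<open>u \<in> open_segment a b\<close> by (auto simp: in_segment)
    have "a \<noteq> u" "b \<noteq> u"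
      using \<open>u \<in> open_segment a b\<close> by (auto simp: open_segment_def)
    then have "(1 - s) * (y \<bullet> a) + s * (y \<bullet> b) < (1 - s) * (y \<bullet> u) + s * (y \<bullet> u)"
      using less ab s by (intro add_strict_mono mult_strict_left_mono) auto
    moreover have "y \<bullet> u = (1 - s) * (y \<bullet> a) + s * (y \<bullet> b)"
      by (simp add: u inner_add_right)
    ultimately show False
      by (simp add: algebra_simps)
  qed
  then show ?thesis
    using \<open>u \<in> K\<close> by (auto simp: vertices_def extreme_point_of_def)
qed

text \<open>The non-zero \<open>y\<close> triggers genericity, which gives a \<open>z\<close>
  interior to both normal cones. Such a \<open>z\<close> is maximised only at \<open>v\<close> on
  \<open>P\<close> and only at \<open>w\<close> on \<open>Q\<close>, hence only at
  \<open>v + w\<close> on the sum.\<close>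

lemma generic_pair_vertex_sum:
  assumes "generic_pair P Q" "v \<in> vertices P" "w \<in> vertices Q"
    and "y \<noteq> 0" "y \<in> normal_cone P v" "y \<in> normal_cone Q w"
  shows "v + w \<in> vertices (P + Q)"
proof -
  have "normal_cone P v \<inter> normal_cone Q w \<noteq> {0}"
    using assms(4-6) by blast
  then obtain z where z: "z \<in> interior (normal_cone P v)" "z \<in> interior (normal_cone Q w)"
    using assms(1-3) unfolding generic_pair_def by blast
  show ?thesis
  proof (rule strict_maximiser_vertex[where y = z])
    show "v + w \<in> P + Q"
      using assms(2,3) vertices_subset by blast
    fix x assume "x \<in> P + Q" "x \<noteq> v + w"
    then obtain p q where "p \<in> P" "q \<in> Q" "x = p + q" "p \<noteq> v \<or> q \<noteq> w"
      by (auto simp: set_plus_def)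
    then show "z \<bullet> x < z \<bullet> (v + w)"
      using interior_normal_cone_less[OF z(1), of p] interior_normal_cone_less[OF z(2), of q]
      by (cases "p = v"; cases "q = w") (auto simp: inner_add_right)
  qed
qed

text \<open>The maximum \<open>y \<bullet> p\<close> is a weighted mean of
  \<open>y \<bullet> p'\<close> and \<open>y \<bullet> v\<close>, neither of which exceeds it when
  \<open>v\<close> lies in \<open>P\<close>; the positive weight \<open>l\<close> forces
  \<open>v\<close> to attain it as well.\<close>

lemma maximiser_generating_vertex:
  assumes max: "\<And>x. x \<in> P \<Longrightarrow> y \<bullet> x \<le> y \<bullet> p"
    and "p' \<in> P" "p = (1 - l) *\<^sub>R p' + l *\<^sub>R v" "0 < l" "l \<le> 1"
  shows "y \<in> normal_cone P v"
proof -
  have "y \<bullet> p = (1 - l) * (y \<bullet> p') + l * (y \<bullet> v)"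
    by (simp add: assms(3) inner_add_right)
  moreover have "(1 - l) * (y \<bullet> p') \<le> (1 - l) * (y \<bullet> p)"
    using max[OF assms(2)] assms(5) by (simp add: mult_left_mono)
  ultimately have "l * (y \<bullet> p) \<le> l * (y \<bullet> v)"
    by (simp add: algebra_simps)
  then have "y \<bullet> p \<le> y \<bullet> v"
    using \<open>0 < l\<close> by simp
  then show ?thesis
    using max by (force simp: normal_cone_def inner_diff_right)
qed

lemma supporting_functional_not_interior:
  fixes K :: "'a::euclidean_space set"
  assumes "convex K" "x \<in> K" "x \<notin> interior K"
  obtains y where "y \<noteq> 0" "\<And>z. z \<in> K \<Longrightarrow> y \<bullet> z \<le> y \<bullet> x"
proof (cases "interior K = {}")
  case True
  \<comment> \<open>A convex set without interior lies in a hyperplane, whose normal is constant on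
    it.\<close>
  obtain a b where "a \<noteq> 0" "K \<subseteq> {z. a \<bullet> z = b}"
    using empty_interior_subset_hyperplane[OF \<open>convex K\<close> True] by metis
  then show ?thesis
    using that[of a] \<open>x \<in> K\<close> by (auto simp: subset_iff)
next
  case False
  then have "x \<notin> rel_interior K"
    using assms(3) by (simp add: rel_interior_nonempty_interior)
  then obtain a where "a \<noteq> 0" "\<And>z. z \<in> K \<Longrightarrow> a \<bullet> x \<le> a \<bullet> z"
    using supporting_hyperplane_rel_boundary[OF assms(1,2)] by metis
  then show ?thesis
    using that[of "- a"] by simp
qed

lemma polytope_set_plus:
  assumes "polytope P" "polytope Q"
  shows "polytope (P + Q)"
  using assms unfolding polytope_def by (metis convex_hull_set_plus finite_set_plus)

lemma generated_at_frontier_sum: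
  assumes "generic_pair P Q" "0 < l" "l \<le> 1"
    and genP: "\<And>x. x \<in> P \<Longrightarrow> generated_at l P x"
    and genQ: "\<And>x. x \<in> Q \<Longrightarrow> generated_at l Q x"
    and "x \<in> P + Q" "x \<notin> interior (P + Q)"
  shows "generated_at l (P + Q) x"
proof -
  have "convex (P + Q)"
    using assms(1) by (simp add: generic_pair_def polytope_imp_convex convex_set_plus)
  then obtain y where "y \<noteq> 0" and y: "\<And>z. z \<in> P + Q \<Longrightarrow> y \<bullet> z \<le> y \<bullet> x"
    using supporting_functional_not_interior assms(6,7) by metis
  obtain p q where p: "p \<in> P" and q: "q \<in> Q" and x: "x = p + q"
    using \<open>x \<in> P + Q\<close> by (auto simp: set_plus_def)
  \<comment> \<open>Varying one summand with the other held fixed splits the maximality of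
    \<open>x\<close> into that of \<open>p\<close> and of \<open>q\<close>.\<close>
  have maxP: "y \<bullet> z \<le> y \<bullet> p" if "z \<in> P" for z
    using y[of "z + q"] that q by (auto simp: x inner_add_right)
  have maxQ: "y \<bullet> z \<le> y \<bullet> q" if "z \<in> Q" for z
    using y[of "p + z"] that p by (auto simp: x inner_add_right)
  obtain p' v where v: "p' \<in> P" "v \<in> vertices P" "p = (1 - l) *\<^sub>R p' + l *\<^sub>R v"
    using genP[OF p] by (auto simp: generated_at_def)
  obtain q' w where w: "q' \<in> Q" "w \<in> vertices Q" "q = (1 - l) *\<^sub>R q' + l *\<^sub>R w"
    using genQ[OF q] by (auto simp: generated_at_def)
  have "y \<in> normal_cone P v" "y \<in> normal_cone Q w"
    using maximiser_generating_vertex[OF maxP v(1,3)] maximiser_generating_vertex[OF maxQ w(1,3)]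
      assms(2,3) by auto
  then have "v + w \<in> vertices (P + Q)"
    using generic_pair_vertex_sum assms(1) v w \<open>y \<noteq> 0\<close> by blast
  moreover have "p' + q' \<in> P + Q"
    using v w by blast
  moreover have "x = (1 - l) *\<^sub>R (p' + q') + l *\<^sub>R (v + w)"
    by (simp add: x v(3) w(3) algebra_simps)
  ultimately show ?thesis
    unfolding generated_at_def by blast
qed

section \<open>Central symmetry and interior points\<close>

text \<open>The vertex \<open>u\<close> that generates \<open>b\<close> also generates the centre,
  with partner \<open>r\<close>. Interpolating between the partners \<open>r\<close> and
  \<open>b'\<close> then handles the whole segment from \<open>c\<close> to \<open>b\<close> with
  this one vertex.\<close>

lemma generated_at_towards_centre:
  assumes "convex K" and sym: "\<And>x. x \<in> K \<Longrightarrow> 2 *\<^sub>R c - x \<in> K" and "c \<in> K"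
    and "generated_at l K b" "0 \<le> l" "l \<le> 1 / 2" "0 \<le> t" "t \<le> 1"
  shows "generated_at l K (c + t *\<^sub>R (b - c))"
proof -
  obtain b' u where b': "b' \<in> K" and u: "u \<in> vertices K" and b: "b = (1 - l) *\<^sub>R b' + l *\<^sub>R u"
    using assms(4) by (auto simp: generated_at_def)
  \<comment> \<open>Solving \<open>c = (1 - l) *\<^sub>R r + l *\<^sub>R u\<close> gives
    \<open>r = c + s *\<^sub>R (c - u)\<close>. This lies between \<open>c\<close> and the
    reflection of \<open>u\<close> because \<open>l \<le> 1 / 2\<close> makes
    \<open>s \<le> 1\<close>.\<close>
  define s where "s = l / (1 - l)"
  have s: "0 \<le> s" "s \<le> 1" "(1 - l) * s = l"
    using assms(5,6) by (auto simp: s_def field_simps)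
  define r where "r = (1 - s) *\<^sub>R c + s *\<^sub>R (2 *\<^sub>R c - u)"
  define z where "z = (1 - t) *\<^sub>R r + t *\<^sub>R b'"
  have "r \<in> K"
    unfolding r_def using assms(1,3) s sym[OF vertices_subset[OF u]] by (intro convexD) auto
  then have "z \<in> K"
    unfolding z_def using assms(1,7,8) b' by (intro convexD) auto
  moreover have "c + t *\<^sub>R (b - c) = (1 - l) *\<^sub>R z + l *\<^sub>R u"
  proof -
    have "(1 - l) *\<^sub>R z =
        (1 - t) *\<^sub>R ((1 - l) *\<^sub>R c + ((1 - l) * s) *\<^sub>R (c - u)) + (t * (1 - l)) *\<^sub>R b'"
      by (simp add: z_def r_def algebra_simps scaleR_2)
    then show ?thesis
      unfolding s(3) by (simp only: b) (simp add: algebra_simps scaleR_2)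
  qed
  ultimately show ?thesis
    using u by (auto simp: generated_at_def)
qed

lemma ray_from_centre_to_frontier:
  fixes K :: "'a::euclidean_space set"
  assumes "bounded K" "x \<in> interior K"
  obtains b t where "b \<in> frontier K" "0 \<le> t" "t \<le> 1" "x = c + t *\<^sub>R (b - c)"
proof (cases "x = c")
  case True
  \<comment> \<open>No direction is distinguished at the centre: any frontier point will do, with
    \<open>t = 0\<close>.\<close>
  obtain e :: 'a where "e \<noteq> 0"
    using nonzero_Basis nonempty_Basis by blast
  then obtain d where "x + d *\<^sub>R e \<in> frontier K"
    using ray_to_frontier[OF assms] by metis
  then show ?thesis
    using that[of _ 0] True by simp
next
  case False
  then obtain d where d: "0 < d" "x + d *\<^sub>R (x - c) \<in> frontier K"
    using ray_to_frontier[OF assms, of "x - c"] by auto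
  \<comment> \<open>Seen from \<open>c\<close>, the frontier point is \<open>x\<close> stretched by
    \<open>1 + d\<close>, whence \<open>t = 1 / (1 + d)\<close>.\<close>
  have "x + d *\<^sub>R (x - c) - c = (1 + d) *\<^sub>R (x - c)"
    by (simp add: algebra_simps)
  then have "x = c + (1 / (1 + d)) *\<^sub>R (x + d *\<^sub>R (x - c) - c)"
    using d(1) by simp
  then show ?thesis
    using that[OF d(2), of "1 / (1 + d)"] d(1) by simp
qed

lemma centrally_symmetric_sum:
  assumes "centrally_symmetric P" "centrally_symmetric Q"
  shows "centrally_symmetric (P + Q)"
proof -
  obtain c d where "P = (\<lambda>x. 2 *\<^sub>R c - x) ` P" "Q = (\<lambda>x. 2 *\<^sub>R d - x) ` Q"
    using assms by (auto simp: centrally_symmetric_def)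
  then have *: "2 *\<^sub>R c - p \<in> P" "2 *\<^sub>R d - q \<in> Q" if "p \<in> P" "q \<in> Q" for p q
    using that by blast+
  have sym: "2 *\<^sub>R (c + d) - x \<in> P + Q" if x: "x \<in> P + Q" for x
  proof -
    obtain p q where "p \<in> P" "q \<in> Q" "x = p + q"
      using x by (auto simp: set_plus_def)
    moreover from this have "(2 *\<^sub>R c - p) + (2 *\<^sub>R d - q) \<in> P + Q"
      using * by blast
    ultimately show ?thesis
      by (simp add: algebra_simps)
  qed
  have "x \<in> (\<lambda>x. 2 *\<^sub>R (c + d) - x) ` (P + Q)" if "x \<in> P + Q" for x
    using sym[OF that] by (intro image_eqI[of _ _ "2 *\<^sub>R (c + d) - x"]) auto
  with sym have "P + Q = (\<lambda>x. 2 *\<^sub>R (c + d) - x) ` (P + Q)"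
    by blast
  then show ?thesis
    unfolding centrally_symmetric_def by blast
qed

theorem proposition1p7:
  fixes P Q :: "(real ^ 'n) set" and l :: real
  assumes "1 / (real CARD('n) + 1) \<le> l" and "l \<le> 1 / 2"
    and "P \<in> VG l" and "Q \<in> VG l"
    and "centrally_symmetric P" and "centrally_symmetric Q"
    and "generic_pair P Q"
  shows "P + Q \<in> VG l"
proof (rule VG_I)
  have "polytope P" "polytope Q" "P \<noteq> {}" "Q \<noteq> {}"
    using assms(3,4) by (auto simp: VG_def)
  then show poly: "polytope (P + Q)" and ne: "P + Q \<noteq> {}"
    by (auto simp: polytope_set_plus)
  show "0 < l"
    using assms(1) by (rule less_le_trans[rotated]) (simp add: add_pos_nonneg)
  show "l \<le> 1"
    using assms(2) by simp
  fix m x assume m: "0 < m" "m < l" and x: "x \<in> P + Q"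
  \<comment> \<open>As \<open>m < l\<close>, both summands are generated at each of their points
    with parameter \<open>m\<close>.\<close>
  have front: "generated_at m (P + Q) b" if "b \<in> P + Q" "b \<notin> interior (P + Q)" for b
    using assms m that
    by (intro generated_at_frontier_sum) (auto intro: VG_generated_at[where k = l])
  have conv: "convex (P + Q)" and closed: "closed (P + Q)" and bdd: "bounded (P + Q)"
    using poly by (simp_all add: polytope_imp_convex polytope_imp_closed polytope_imp_bounded)
  obtain c where "P + Q = (\<lambda>x. 2 *\<^sub>R c - x) ` (P + Q)"
    using centrally_symmetric_sum[OF assms(5,6)] by (auto simp: centrally_symmetric_def)
  then have sym: "2 *\<^sub>R c - y \<in> P + Q" if "y \<in> P + Q" for y
    using that by blast
  \<comment> \<open>The centre is the midpoint of \<open>x\<close> and its reflection, so it belongs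
    to the sum.\<close>
  have "(1 / 2) *\<^sub>R x + (1 / 2) *\<^sub>R (2 *\<^sub>R c - x) \<in> P + Q"
    using conv x sym[OF x] by (intro convexD) auto
  then have c: "c \<in> P + Q"
    by (simp add: algebra_simps)
  show "generated_at m (P + Q) x"
  proof (cases "x \<in> interior (P + Q)")
    case True
    then obtain b t where b: "b \<in> frontier (P + Q)" and t: "0 \<le> t" "t \<le> 1"
      and "x = c + t *\<^sub>R (b - c)"
      using ray_from_centre_to_frontier[OF bdd] by metis
    \<comment> \<open>Closedness puts the frontier point \<open>b\<close> in \<open>P + Q\<close>
      itself, outside the interior.\<close>
    moreover have "generated_at m (P + Q) b"
      using b closed by (intro front) (auto simp: frontier_def)
    ultimately show ?thesis
      using generated_at_towards_centre[OF conv sym c] m assms(2) by auto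
  qed (use front x in blast)
qed

end
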